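(* Let $K$ be an algebraically closed field, let $d\ge 0$ and $n\ge d+1$ be integers, let $X\subset K^n$ be a $(d+1)$-dimensional linear subspace, and let $L(X)\subset \mathrm{Gr}(d,n)\subset \mathbb{P}^{\binom{n}{d}-1}$ be the moduli space of $d$-dimensional linear subspaces contained in $X$. Then $L(X)$ is itself a $d$-dimensional projective (linear) subspace of $\mathbb{P}^{\binom{n}{d}-1}$. Indeed, if $X$ is the rowspace of a matrix $W\in K^{(d+1)\times n}$, then $L(X)$ is equal to (the projectivization of) the rowspace of the matrix $V\in K^{(d+1)\times\binom{n}{d}}$ with entries $$V_{i,J}=(-1)^{i+1}\det(W_{-i}^J),\qquad i\in[d+1],\ J\in\tbinom{[n]}{d},$$ where $W_{-i}^J$ is the square submatrix of $W$ with rows indexed by $[d+1]\setminus\{i\}$ and columns indexed by $J$.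
   Context: $[n]=\{1,\dots,n\}$ and $\binom{[n]}{m}$ is the set of $m$-element subsets of $[n]$. $\mathrm{Gr}(m,n)$ is the Grassmannian of $m$-dimensional linear subspaces of $K^n$, embedded in $\mathbb{P}^{\binom{n}{m}-1}$ (coordinates indexed by $\binom{[n]}{m}$) by the Plücker embedding: the rowspace of a full-rank matrix $M\in K^{m\times n}$ is sent to the vector $(\det(M^I))_{I\in\binom{[n]}{m}}$, where $M^I$ is the submatrix of $M$ with columns indexed by $I$ (in increasing order). $L(X)$ is the set of points of $\mathrm{Gr}(d,n)$ corresponding to $d$-dimensional subspaces $Y\subset K^n$ with $Y\subset X$. *)

theory Defs
  imports
    "Jordan_Normal_Form.DL_Rank"
    "Jordan_Normal_Form.DL_Submatrix"
    "HOL-Library.Function_Algebras"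
begin

text \<open>
  Vectors in \<open>K^n\<close> and matrices are those of Jordan_Normal_Form, so \<open>[n]\<close> is rendered as
  \<open>{..<n}\<close>, and rows and columns are numbered from 0.
\<close>

definition linear_subspace :: "nat \<Rightarrow> nat \<Rightarrow> 'a::field vec set \<Rightarrow> bool" where
  "linear_subspace n k X \<longleftrightarrow>
     VectorSpace.subspace class_ring X (module_vec TYPE('a) n) \<and>
     vectorspace.dim class_ring ((module_vec TYPE('a) n)\<lparr>carrier := X\<rparr>) = k"

definition index_sets :: "nat \<Rightarrow> nat \<Rightarrow> nat set set" where
  "index_sets n m = {J. J \<subseteq> {..<n} \<and> card J = m}"

text \<open>
  Coordinate vectors indexed by a set \<open>I\<close> of labels are functions vanishing outside \<open>I\<close>;
  this avoids choosing an enumeration of the \<open>m\<close>-element subsets of \<open>[n]\<close>.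
\<close>

definition scale_fun :: "'a::field \<Rightarrow> ('i \<Rightarrow> 'a) \<Rightarrow> 'i \<Rightarrow> 'a" where
  "scale_fun c f = (\<lambda>x. c * f x)"

interpretation fun_vs: vector_space "scale_fun :: 'a::field \<Rightarrow> ('i \<Rightarrow> 'a) \<Rightarrow> 'i \<Rightarrow> 'a"
  by unfold_locales (auto simp: scale_fun_def algebra_simps fun_eq_iff)

definition coord_space :: "'i set \<Rightarrow> ('i \<Rightarrow> 'a::field) set" where
  "coord_space I = {f. \<forall>x. x \<notin> I \<longrightarrow> f x = 0}"

text \<open>A point of a projective space is a line through the origin.\<close>

definition proj_point :: "('i \<Rightarrow> 'a::field) \<Rightarrow> ('i \<Rightarrow> 'a) set" where
  "proj_point v = fun_vs.span {v}"

definition projectivization :: "('i \<Rightarrow> 'a::field) set \<Rightarrow> ('i \<Rightarrow> 'a) set set" where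
  "projectivization U = {proj_point v | v. v \<in> U \<and> v \<noteq> 0}"

definition proj_linear_subspace :: "'i set \<Rightarrow> nat \<Rightarrow> ('i \<Rightarrow> 'a::field) set set \<Rightarrow> bool" where
  "proj_linear_subspace I k S \<longleftrightarrow>
     (\<exists>U. fun_vs.subspace U \<and> U \<subseteq> coord_space I \<and> fun_vs.dim U = k + 1 \<and>
          S = projectivization U)"

definition plucker_coords :: "'a::field mat \<Rightarrow> nat set \<Rightarrow> 'a" where
  "plucker_coords M =
     (\<lambda>J. if J \<in> index_sets (dim_col M) (dim_row M) then det (submatrix M UNIV J) else 0)"

text \<open>
  The Pluecker embedding, as the relation between a subspace \<open>Y\<close> of \<open>K^n\<close> and its image \<open>p\<close>;
  any full-rank matrix with row space \<open>Y\<close> may be used to compute \<open>p\<close>.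
\<close>

definition plucker_embeds :: "nat \<Rightarrow> nat \<Rightarrow> 'a::field vec set \<Rightarrow> (nat set \<Rightarrow> 'a) set \<Rightarrow> bool" where
  "plucker_embeds m n Y p \<longleftrightarrow>
     (\<exists>M \<in> carrier_mat m n. vec_space.rank m M = m \<and> vec_space.row_space n M = Y \<and>
        p = proj_point (plucker_coords M))"

definition Gr :: "nat \<Rightarrow> nat \<Rightarrow> (nat set \<Rightarrow> 'a::field) set set" where
  "Gr m n = {p. \<exists>Y. linear_subspace n m Y \<and> plucker_embeds m n Y p}"

definition L :: "nat \<Rightarrow> nat \<Rightarrow> 'a::field vec set \<Rightarrow> (nat set \<Rightarrow> 'a) set set" where
  "L d n X = {p \<in> Gr d n. \<exists>Y. linear_subspace n d Y \<and> Y \<subseteq> X \<and> plucker_embeds d n Y p}"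

text \<open>
  The \<open>i\<close>-th row of the matrix \<open>V\<close>. With rows numbered from 0, the sign \<open>(-1)^(i+1)\<close> for
  \<open>i \<in> {1..d+1}\<close> becomes \<open>(-1)^i\<close>.
\<close>

definition minor_matrix :: "nat \<Rightarrow> nat \<Rightarrow> 'a::field mat \<Rightarrow> nat \<Rightarrow> nat set \<Rightarrow> 'a" where
  "minor_matrix d n W i =
     (\<lambda>J. if J \<in> index_sets n d then (-1) ^ i * det (submatrix W ({..<d + 1} - {i}) J) else 0)"

definition minor_row_space :: "nat \<Rightarrow> nat \<Rightarrow> 'a::field mat \<Rightarrow> (nat set \<Rightarrow> 'a) set" where
  "minor_row_space d n W = fun_vs.span (minor_matrix d n W ` {..<d + 1})"

end

theory Submission
  imports
    Defs
    "Jordan_Normal_Form.DL_Rank_Submatrix"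
    "Jordan_Normal_Form.Schur_Decomposition"
begin

text \<open>
  By Laplace expansion along the first column, the combination \<open>\<Sum>i. c\<^sub>i V\<^sub>i\<close> of the rows of \<open>V\<close> has
  \<open>J\<close>-th coordinate \<open>det [c | W\<^sup>J]\<close>. This determinant is multiplied by \<open>det P\<close> when \<open>c\<close> and \<open>W\<close> are
  replaced by \<open>P c\<close> and \<open>P W\<close>. If \<open>c \<noteq> 0\<close>, some invertible \<open>P\<close> sends \<open>c\<close> to the first unit vector,
  and then the determinant becomes the \<open>J\<close>-th minor of the last \<open>d\<close> rows of \<open>P W\<close>. So \<open>\<Sum>i. c\<^sub>i V\<^sub>i\<close> is,
  up to a nonzero scalar, the Pluecker vector of a hyperplane of \<open>X\<close>; in particular it is nonzero.
  Conversely, a hyperplane of \<open>X\<close> is the row space of some \<open>A W\<close>, and a nonzero \<open>c\<close> in the kernel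
  of \<open>A\<close> exhibits its Pluecker vector as such a combination.
\<close>

section \<open>Bordered determinants and maximal minors\<close>

text \<open>The vector goes in column 0, so the Laplace sign of row \<open>i\<close> is
  \<open>(-1) ^ (i + 0)\<close>, exactly the sign carried by \<open>minor_matrix\<close>.\<close>

definition border :: "'a vec \<Rightarrow> 'a mat \<Rightarrow> 'a mat" where
  "border c A = mat (dim_row A) (Suc (dim_col A)) (\<lambda>(i, j). if j = 0 then c $ i else A $$ (i, j - 1))"

definition drop_first_row :: "'a mat \<Rightarrow> 'a mat" where
  "drop_first_row A = mat (dim_row A - 1) (dim_col A) (\<lambda>(i, j). A $$ (Suc i, j))"

lemma border_carrier[simp]:
  assumes "A \<in> carrier_mat m n"
  shows "border c A \<in> carrier_mat m (Suc n)"
  using assms by (auto simp: border_def)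

lemma drop_first_row_carrier[simp]:
  assumes "A \<in> carrier_mat (Suc m) n"
  shows "drop_first_row A \<in> carrier_mat m n"
  using assms by (auto simp: drop_first_row_def)

lemma index_sets_Collect:
  assumes "J \<in> index_sets n r"
  shows "{j. j < n \<and> j \<in> J} = J" "finite J" "card J = r"
  using assms by (auto simp: index_sets_def intro: finite_subset)

lemma submatrix_UNIV_carrier:
  assumes "A \<in> carrier_mat m n" "J \<in> index_sets n r"
  shows "submatrix A UNIV J \<in> carrier_mat m r"
  using assms index_sets_Collect[OF assms(2)] by (auto simp: submatrix_def)

lemma pick_index_sets:
  assumes "J \<in> index_sets n r" "j < r"
  shows "pick J j \<in> J" "pick J j < n"
proof -
  show "pick J j \<in> J" using pick_in_set_le[of j J] index_sets_Collect[OF assms(1)] assms(2) by simp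
  then show "pick J j < n" using assms(1) by (auto simp: index_sets_def)
qed

lemma submatrix_UNIV_index:
  assumes "A \<in> carrier_mat m n" "J \<in> index_sets n r" "i < m" "j < r"
  shows "submatrix A UNIV J $$ (i, j) = A $$ (i, pick J j)"
  using submatrix_index[of i A UNIV j J] index_sets_Collect[OF assms(2)] assms
  by (simp add: pick_UNIV)

text \<open>Left multiplication acts on each column separately. Hence a square factor on the left
  scales all maximal minors by its determinant, whatever \<open>J\<close> is.\<close>

lemma submatrix_mult:
  assumes "P \<in> carrier_mat k m" "A \<in> carrier_mat m n" "J \<in> index_sets n r"
  shows "submatrix (P * A) UNIV J = P * submatrix A UNIV J"
proof (rule eq_matI)
  note c = submatrix_UNIV_carrier[OF mult_carrier_mat[OF assms(1,2)] assms(3)]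
    submatrix_UNIV_carrier[OF assms(2,3)]
  show "dim_row (submatrix (P * A) UNIV J) = dim_row (P * submatrix A UNIV J)"
    "dim_col (submatrix (P * A) UNIV J) = dim_col (P * submatrix A UNIV J)"
    using c assms by auto
  fix i j assume "i < dim_row (P * submatrix A UNIV J)" "j < dim_col (P * submatrix A UNIV J)"
  then have ij: "i < k" "j < r" using c assms by auto
  then show "submatrix (P * A) UNIV J $$ (i, j) = (P * submatrix A UNIV J) $$ (i, j)"
    using c assms pick_index_sets[OF assms(3) ij(2)]
    by (auto simp: submatrix_UNIV_index[OF mult_carrier_mat[OF assms(1,2)] assms(3) ij] scalar_prod_def
        submatrix_UNIV_index[OF assms(2,3)] intro!: sum.cong)
qed

lemma border_mult:
  assumes "P \<in> carrier_mat k m" "A \<in> carrier_mat m n" "c \<in> carrier_vec m"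
  shows "P * border c A = border (P *\<^sub>v c) (P * A)"
  using assms by (intro eq_matI) (auto simp: border_def scalar_prod_def intro!: sum.cong)

lemma drop_first_row_mult:
  assumes "P \<in> carrier_mat (Suc k) m" "A \<in> carrier_mat m n"
  shows "drop_first_row (P * A) = drop_first_row P * A"
  using assms by (intro eq_matI) (auto simp: drop_first_row_def scalar_prod_def intro!: sum.cong)

lemma submatrix_drop_first_row:
  assumes "A \<in> carrier_mat (Suc m) n" "J \<in> index_sets n r"
  shows "submatrix (drop_first_row A) UNIV J = drop_first_row (submatrix A UNIV J)"
proof (rule eq_matI)
  note c = submatrix_UNIV_carrier[OF drop_first_row_carrier[OF assms(1)] assms(2)]
    submatrix_UNIV_carrier[OF assms]
  show "dim_row (submatrix (drop_first_row A) UNIV J) = dim_row (drop_first_row (submatrix A UNIV J))"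
    "dim_col (submatrix (drop_first_row A) UNIV J) = dim_col (drop_first_row (submatrix A UNIV J))"
    using c assms by (auto simp: drop_first_row_def)
  fix i j assume "i < dim_row (drop_first_row (submatrix A UNIV J))"
    "j < dim_col (drop_first_row (submatrix A UNIV J))"
  then have ij: "i < m" "j < r" using c assms by (auto simp: drop_first_row_def)
  then show "submatrix (drop_first_row A) UNIV J $$ (i, j) = drop_first_row (submatrix A UNIV J) $$ (i, j)"
    using c assms pick_index_sets[OF assms(2) ij(2)]
    unfolding submatrix_UNIV_index[OF drop_first_row_carrier[OF assms(1)] assms(2) ij]
    by (auto simp: submatrix_UNIV_index[OF assms] drop_first_row_def)
qed

text \<open>Reconciles two ways of skipping row \<open>i\<close>: \<open>submatrix\<close>
  enumerates the remaining indices with \<open>pick\<close>, whereas \<open>mat_delete\<close>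
  shifts them past \<open>i\<close>. An element of a set is the \<open>r\<close>-th one, counted
  from 0, when exactly \<open>r\<close> elements lie below it.\<close>

lemma pick_Diff_singleton:
  assumes "i < Suc m" "r < m"
  shows "pick ({..<Suc m} - {i}) r = insert_index i r"
proof -
  let ?S = "{..<Suc m} - {i}"
  have "insert_index i r \<in> ?S" using assms by (auto simp: insert_index_def)
  moreover have "card {a \<in> ?S. a < insert_index i r} = r"
  proof (cases "r < i")
    case True
    then have "{a \<in> ?S. a < insert_index i r} = {..<r}" using assms by auto
    then show ?thesis by simp
  next
    case False
    then have "{a \<in> ?S. a < insert_index i r} = {..<Suc r} - {i}" using assms by auto
    then show ?thesis using False by simp
  qed
  ultimately show ?thesis using pick_card_in_set[of "insert_index i r" ?S] by simp
qed

lemma mat_delete_border: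
  assumes "A \<in> carrier_mat (Suc m) n" "i < Suc m"
  shows "mat_delete (border c A) i 0 = submatrix A ({..<Suc m} - {i}) UNIV"
proof -
  have "{k. k < Suc m \<and> k \<in> {..<Suc m} - {i}} = {..<Suc m} - {i}" by auto
  then have "card {k. k < Suc m \<and> k \<in> {..<Suc m} - {i}} = m" using assms(2) by simp
  then show ?thesis using assms
    by (intro eq_matI)
       (auto simp: mat_delete_def border_def submatrix_def pick_UNIV pick_Diff_singleton insert_index_def)
qed

lemma det_border:
  assumes "A \<in> carrier_mat (Suc d) d"
  shows "det (border c A) =
    (\<Sum>i<Suc d. c $ i * ((-1) ^ i * det (submatrix A ({..<Suc d} - {i}) UNIV)))"
proof -
  have "det (border c A) = (\<Sum>i<Suc d. border c A $$ (i, 0) * cofactor (border c A) i 0)"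
    using assms by (intro laplace_expansion_column) auto
  also have "\<dots> = (\<Sum>i<Suc d. c $ i * ((-1) ^ i * det (submatrix A ({..<Suc d} - {i}) UNIV)))"
    using assms by (intro sum.cong) (auto simp: cofactor_def mat_delete_border, auto simp: border_def)
  finally show ?thesis .
qed

lemma det_border_unit_vec:
  assumes "A \<in> carrier_mat (Suc d) d"
  shows "det (border (unit_vec (Suc d) 0) A) = det (drop_first_row A)"
proof -
  let ?B = "border (unit_vec (Suc d) 0) A"
  have del: "mat_delete ?B 0 0 = drop_first_row A"
    using assms by (intro eq_matI) (auto simp: mat_delete_def border_def drop_first_row_def)
  have "det ?B = (\<Sum>i<Suc d. ?B $$ (i, 0) * cofactor ?B i 0)"
    using assms by (intro laplace_expansion_column) auto
  also have "\<dots> = (\<Sum>i<Suc d. if i = 0 then det (drop_first_row A) else 0)"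
    using assms by (intro sum.cong) (auto simp: cofactor_def del, auto simp: border_def)
  finally show ?thesis by simp
qed

section \<open>Linear combinations of the rows of V\<close>

definition minor_comb :: "nat \<Rightarrow> nat \<Rightarrow> 'a::field mat \<Rightarrow> 'a vec \<Rightarrow> nat set \<Rightarrow> 'a" where
  "minor_comb d n W c = (\<Sum>i<Suc d. scale_fun (c $ i) (minor_matrix d n W i))"

lemma sum_fun_apply: "(\<Sum>i\<in>I. f i) x = (\<Sum>i\<in>I. f i x)"
  by (induction I rule: infinite_finite_induct) auto

lemma minor_comb_eq_det:
  assumes "W \<in> carrier_mat (Suc d) n"
  shows "minor_comb d n W c J =
    (if J \<in> index_sets n d then det (border c (submatrix W UNIV J)) else 0)"
proof (cases "J \<in> index_sets n d")
  case True
  show ?thesis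
    \<comment> \<open>\<open>submatrix_split\<close> selects the columns \<open>J\<close> first and
      then deletes a row, the order in which \<open>det_border\<close> produces the minors.\<close>
    using det_border[OF submatrix_UNIV_carrier[OF assms True]] True
      submatrix_split[of W "{..<Suc d} - {_}" J]
    by (simp add: minor_comb_def sum_fun_apply scale_fun_def minor_matrix_def del: sum.lessThan_Suc)
next
  case False
  then show ?thesis by (simp add: minor_comb_def sum_fun_apply scale_fun_def minor_matrix_def)
qed

lemma plucker_coords_drop_first_row:
  assumes W: "W \<in> carrier_mat (Suc d) n" and P: "P \<in> carrier_mat (Suc d) (Suc d)"
    and c: "c \<in> carrier_vec (Suc d)" and Pc: "P *\<^sub>v c = unit_vec (Suc d) 0"
  shows "plucker_coords (drop_first_row (P * W)) = scale_fun (det P) (minor_comb d n W c)"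
proof
  fix J
  note PW = mult_carrier_mat[OF P W]
  show "plucker_coords (drop_first_row (P * W)) J = scale_fun (det P) (minor_comb d n W c) J"
  proof (cases "J \<in> index_sets n d")
    case True
    note S = submatrix_UNIV_carrier[OF W True]
    have "det (submatrix (drop_first_row (P * W)) UNIV J) = det (drop_first_row (submatrix (P * W) UNIV J))"
      by (simp add: submatrix_drop_first_row[OF PW True])
    also have "\<dots> = det (border (unit_vec (Suc d) 0) (submatrix (P * W) UNIV J))"
      by (simp add: det_border_unit_vec[OF submatrix_UNIV_carrier[OF PW True]])
    also have "\<dots> = det (P * border c (submatrix W UNIV J))"
      by (simp add: border_mult[OF P S c] Pc submatrix_mult[OF P W True])
    also have "\<dots> = det P * det (border c (submatrix W UNIV J))"
      by (rule det_mult[OF P border_carrier[OF S]])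
    finally show ?thesis
      using True W P PW by (simp add: plucker_coords_def minor_comb_eq_det scale_fun_def drop_first_row_def)
  next
    case False
    then show ?thesis
      using W P PW by (simp add: plucker_coords_def minor_comb_eq_det scale_fun_def drop_first_row_def)
  qed
qed

text \<open>Complete \<open>c\<close> to a basis and take the basis vectors as columns of
  \<open>Q\<close>. Its inverse \<open>P\<close> then maps column 0 of \<open>Q\<close>, which is
  \<open>c\<close>, to column 0 of the identity.\<close>

lemma invertible_first_column:
  fixes c :: "'a::field vec"
  assumes c: "c \<in> carrier_vec (Suc d)" "c \<noteq> 0\<^sub>v (Suc d)"
  obtains P Q where "P \<in> carrier_mat (Suc d) (Suc d)" "Q \<in> carrier_mat (Suc d) (Suc d)"
    "P * Q = 1\<^sub>m (Suc d)" "Q * P = 1\<^sub>m (Suc d)" "col Q 0 = c" "P *\<^sub>v c = unit_vec (Suc d) 0" "det P \<noteq> 0"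
proof -
  interpret vec_space "TYPE('a)" "Suc d" .
  define Q where "Q = mat_of_cols (Suc d) (basis_completion c)"
  note bc = basis_completion[OF c]
  have Q: "Q \<in> carrier_mat (Suc d) (Suc d)" using bc(6) by (auto simp: Q_def)
  have cols: "cols Q = basis_completion c" using bc(2) by (simp add: Q_def cols_mat_of_cols)
  have "det Q \<noteq> 0" using lin_indpt_full_rank[OF Q] bc det_rank_iff[OF Q] by (simp add: cols)
  from det_non_zero_imp_unit[OF Q this, of "()"] obtain P where
    P: "P \<in> carrier_mat (Suc d) (Suc d)" "P * Q = 1\<^sub>m (Suc d)" "Q * P = 1\<^sub>m (Suc d)"
    by (auto simp: Units_def ring_mat_simps)
  have cQ: "col Q 0 = c" using cols_nth[of 0 Q] cols bc(6,7) Q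
    by (metis hd_conv_nth carrier_matD(2) length_0_conv nat.distinct(1) zero_less_Suc)
  have "P *\<^sub>v c = col (P * Q) 0" by (simp only: col_mult2[OF P(1) Q zero_less_Suc] cQ)
  then have "P *\<^sub>v c = unit_vec (Suc d) 0" by (simp add: P)
  moreover have "det P \<noteq> 0" using det_mult[OF P(1) Q] P by auto
  ultimately show ?thesis using that P Q cQ by blast
qed

text \<open>Padding \<open>A\<close> with zero rows to a square matrix \<open>B\<close> makes the
  determinant criterion for singularity applicable.\<close>

lemma mat_kernel_nontrivial:
  fixes A :: "'a::field mat"
  assumes A: "A \<in> carrier_mat r m" and "r < m"
  obtains c where "c \<in> carrier_vec m" "c \<noteq> 0\<^sub>v m" "A *\<^sub>v c = 0\<^sub>v r"
proof -
  define B where "B = mat m m (\<lambda>(i, j). if i < r then A $$ (i, j) else 0)"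
  have B: "B \<in> carrier_mat m m" by (simp add: B_def)
  \<comment> \<open>Row \<open>r\<close> of \<open>B\<close> is the first padded row, so it is zero;
    this exists because \<open>r < m\<close>.\<close>
  have "B\<^sup>T *\<^sub>v unit_vec m r = 0\<^sub>v m"
    using \<open>r < m\<close> by (intro eq_vecI) (auto simp: B_def)
  moreover have "unit_vec m r \<noteq> (0\<^sub>v m :: 'a vec)"
    using \<open>r < m\<close> by (metis index_unit_vec(1) index_zero_vec(1) zero_neq_one)
  moreover have "unit_vec m r \<in> carrier_vec m" by simp
  moreover have "B\<^sup>T \<in> carrier_mat m m" using B by simp
  ultimately have "det (B\<^sup>T) = 0" using det_0_iff_vec_prod_zero_field[of "B\<^sup>T" m] by blast
  then have "det B = 0" using det_transpose[OF B] by simp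
  then obtain c where c: "c \<in> carrier_vec m" "c \<noteq> 0\<^sub>v m" "B *\<^sub>v c = 0\<^sub>v m"
    using det_0_iff_vec_prod_zero_field[OF B] by auto
  have "A *\<^sub>v c = 0\<^sub>v r"
  proof (rule eq_vecI)
    fix i assume "i < dim_vec (0\<^sub>v r :: 'a vec)"
    then have i: "i < r" by simp
    have "row B i = row A i" using i A \<open>r < m\<close> by (intro eq_vecI) (auto simp: B_def)
    then have "(A *\<^sub>v c) $ i = (B *\<^sub>v c) $ i" using i A B \<open>r < m\<close> by simp
    then show "(A *\<^sub>v c) $ i = 0\<^sub>v r $ i" using c i \<open>r < m\<close> by simp
  qed (use A in auto)
  with c that show ?thesis by blast
qed

lemma scale_fun_scale_fun: "scale_fun a (scale_fun b f) = scale_fun (a * b) f"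
  by (simp add: scale_fun_def mult.assoc)

text \<open>
  The coefficient vector \<open>c\<close> is a multiple of a kernel vector of \<open>A\<close>: after a change of basis sending
  it to the first unit vector, the first column of \<open>A\<close> vanishes, so that only the last \<open>d\<close> rows
  of the transformed \<open>W\<close> contribute to \<open>A * W\<close>.
\<close>
lemma plucker_coords_mult:
  fixes A :: "'a::field mat"
  assumes A: "A \<in> carrier_mat d (Suc d)" and W: "W \<in> carrier_mat (Suc d) n"
  obtains c where "c \<in> carrier_vec (Suc d)" "plucker_coords (A * W) = minor_comb d n W c"
proof -
  obtain c where c: "c \<in> carrier_vec (Suc d)" "c \<noteq> 0\<^sub>v (Suc d)" "A *\<^sub>v c = 0\<^sub>v d"
    using mat_kernel_nontrivial[OF A lessI] by blast
  obtain P Q where P: "P \<in> carrier_mat (Suc d) (Suc d)" and Q: "Q \<in> carrier_mat (Suc d) (Suc d)"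
    and QP: "Q * P = 1\<^sub>m (Suc d)" and Q0: "col Q 0 = c" and Pc: "P *\<^sub>v c = unit_vec (Suc d) 0"
    using invertible_first_column[OF c(1,2)] by metis
  define B where "B = A * Q"
  \<comment> \<open>Column 0 of \<open>B\<close> will turn out to be \<open>A *\<^sub>v c\<close>,
    hence zero, so \<open>B'\<close> retains all the information in \<open>B\<close>.\<close>
  define B' where "B' = mat d d (\<lambda>(i, j). B $$ (i, Suc j))"
  have B: "B \<in> carrier_mat d (Suc d)" and B': "B' \<in> carrier_mat d d"
    using A Q by (auto simp: B_def B'_def)
  have "col B 0 = 0\<^sub>v d" unfolding B_def col_mult2[OF A Q zero_less_Suc] Q0 by (rule c(3))
  then have B0: "B $$ (i, 0) = 0" if "i < d" for i
    using that B by (metis carrier_matD index_col index_zero_vec(1) zero_less_Suc)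
  note PW = mult_carrier_mat[OF P W]
  define R where "R = P * W"
  have R: "R \<in> carrier_mat (Suc d) n" using PW by (simp add: R_def)
  define D where "D = drop_first_row R"
  have D: "D \<in> carrier_mat d n" using R by (simp add: D_def)
  have "A * W = A * (Q * P) * W" using A by (simp add: QP)
  also have "\<dots> = A * (Q * (P * W))"
    using assoc_mult_mat[OF A mult_carrier_mat[OF Q P] W] assoc_mult_mat[OF Q P W] by simp
  also have "\<dots> = B * R" using assoc_mult_mat[OF A Q PW] by (simp add: B_def R_def)
  also have "\<dots> = B' * D"
  proof (rule eq_matI)
    fix i j assume "i < dim_row (B' * D)" "j < dim_col (B' * D)"
    then have ij: "i < d" "j < n" using B' D by auto
    have "(B * R) $$ (i, j) = (\<Sum>k<Suc d. B $$ (i, k) * R $$ (k, j))"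
      using B R ij by (simp add: scalar_prod_def lessThan_atLeast0 del: sum.op_ivl_Suc)
    also have "\<dots> = (\<Sum>k<d. B $$ (i, Suc k) * R $$ (Suc k, j))"
      using ij by (simp only: sum.lessThan_Suc_shift) (simp add: B0)
    also have "\<dots> = (B' * D) $$ (i, j)"
      using B B' D R ij
      by (auto simp: scalar_prod_def lessThan_atLeast0 B'_def D_def drop_first_row_def intro!: sum.cong)
    finally show "(B * R) $$ (i, j) = (B' * D) $$ (i, j)" .
  qed (use B B' D R in auto)
  finally have AW: "A * W = B' * D" .
  \<comment> \<open>Both factors have \<open>d\<close> rows, so each maximal minor of the product is
    \<open>det B'\<close> times the corresponding minor of \<open>D\<close>.\<close>
  have "plucker_coords (A * W) = scale_fun (det B') (plucker_coords D)"
  proof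
    fix J
    show "plucker_coords (A * W) J = scale_fun (det B') (plucker_coords D) J"
      using B' D submatrix_mult[OF B' D, of J d] det_mult[OF B' submatrix_UNIV_carrier[OF D, of J d]]
      by (simp add: AW plucker_coords_def scale_fun_def)
  qed
  also have "\<dots> = scale_fun (det B' * det P) (minor_comb d n W c)"
    unfolding D_def R_def plucker_coords_drop_first_row[OF W P c(1) Pc] scale_fun_scale_fun ..
  \<comment> \<open>Linearity in the coefficient vector absorbs the scalar. It is zero when
    \<open>B'\<close> is singular, and then both sides vanish.\<close>
  also have "\<dots> = minor_comb d n W ((det B' * det P) \<cdot>\<^sub>v c)"
    using c(1) by (auto simp: minor_comb_def fun_eq_iff scale_fun_def sum_fun_apply sum_distrib_left mult.assoc
      simp del: sum.lessThan_Suc intro!: sum.cong)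
  finally show ?thesis using that[of "(det B' * det P) \<cdot>\<^sub>v c"] c(1) by simp
qed

section \<open>Row spaces and rank\<close>

text \<open>A column outside the span of a maximal independent set of columns could be added to it.
  The lemma supplies both uses of the rank: as a number of independent columns and as the size of a
  spanning set.\<close>

lemma (in vec_space) maximal_independent_cols:
  assumes M: "M \<in> carrier_mat n nc"
  obtains S where "S \<subseteq> set (cols M)" "lin_indpt S" "finite S" "card S = rank M"
    "set (cols M) \<subseteq> span S"
proof -
  have C: "set (cols M) \<subseteq> carrier_vec n" using cols_dim M by blast
  let ?P = "\<lambda>T. T \<subseteq> set (cols M) \<and> lin_indpt T"
  have "?P {}" by (auto simp: lin_dep_def)
  then obtain S where S: "maximal S ?P" "finite S"
    using maximal_exists_superset[of "set (cols M)" ?P "{}"] by auto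
  have S': "S \<subseteq> set (cols M)" "lin_indpt S" using S by (auto simp: maximal_def)
  have "v \<in> span S" if v: "v \<in> set (cols M)" for v
  proof (rule ccontr)
    assume "v \<notin> span S"
    moreover have "v \<notin> S" using calculation in_own_span[of S] S' C by auto
    ultimately have "lin_indpt (S \<union> {v})"
      using lin_dep_iff_in_span[of S v] S' C v by auto
    then show False using S v \<open>v \<notin> S\<close> unfolding maximal_def by blast
  qed
  with that S' S rank_card_indpt[OF M S(1)] show ?thesis by auto
qed

text \<open>Full row rank provides \<open>m\<close> independent columns; the square submatrix they
  form has rank \<open>m\<close> and so is nonsingular.\<close>

lemma nonzero_minor_if_full_rank:
  fixes M :: "'a::field mat"
  assumes M: "M \<in> carrier_mat m n" and rank: "vec_space.rank m M = m"
  obtains J where "J \<in> index_sets n m" "det (submatrix M UNIV J) \<noteq> 0"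
proof -
  interpret vec_space "TYPE('a)" m .
  obtain S where S: "S \<subseteq> set (cols M)" "lin_indpt S" "card S = m"
    using maximal_independent_cols[OF M] rank by metis
  have "set (cols M) = col M ` {..<n}" using M by (auto simp: cols_def)
  \<comment> \<open>\<open>S\<close> is a set of vectors, and equal columns may occur in
    \<open>M\<close>. Taking one index per vector makes \<open>col M\<close> injective on
    \<open>J\<close>, so that \<open>J\<close> has \<open>m\<close> elements.\<close>
  then obtain J where J: "J \<subseteq> {..<n}" "inj_on (col M) J" "S = col M ` J"
    using S(1) subset_image_inj by metis
  then have Jm: "J \<in> index_sets n m" using S(3) by (auto simp: index_sets_def card_image)
  note fin = index_sets_Collect(2,3)[OF Jm]
  let ?B = "submatrix M UNIV J"
  have B: "?B \<in> carrier_mat m m" by (rule submatrix_UNIV_carrier[OF M Jm])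
  have "inj_on (pick J) {..<m}"
    using fin(2) by (intro inj_onI) (metis pick_mono_le lessThan_iff nat_neq_iff)
  then have "card (pick J ` {..<m}) = card J" using fin(2) by (simp add: card_image)
  then have pick: "pick J ` {..<m} = J"
    using pick_index_sets(1)[OF Jm] fin(1) by (intro card_subset_eq image_subsetI) simp_all
  have col: "col ?B j = col M (pick J j)" if "j < m" for j
    using that B M pick_index_sets(2)[OF Jm that]
    by (intro eq_vecI) (simp_all add: submatrix_UNIV_index[OF M Jm])
  have "set (cols ?B) = col ?B ` {..<m}" using B by (auto simp: cols_def)
  also have "\<dots> = col M ` pick J ` {..<m}" using col by (simp add: image_image)
  finally have "set (cols ?B) = S" by (simp add: pick J(3))
  \<comment> \<open>A list of \<open>m\<close> columns whose set has \<open>m\<close> elements has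
    no repetition.\<close>
  moreover from this have "distinct (cols ?B)" using S(3) B by (intro card_distinct) auto
  ultimately have "rank ?B = m" using lin_indpt_full_rank[OF B] S(2) by simp
  then show ?thesis using that[OF Jm] det_rank_iff[OF B] by simp
qed

lemma plucker_coords_nonzero:
  fixes M :: "'a::field mat"
  assumes "M \<in> carrier_mat k n" "vec_space.rank k M = k"
  shows "plucker_coords M \<noteq> 0"
  using nonzero_minor_if_full_rank[OF assms] assms by (auto simp: plucker_coords_def fun_eq_iff)

text \<open>The hypothesis says that the rows are independent, while \<open>rank\<close> counts
  columns. If fewer than \<open>m\<close> vectors spanned the columns, orthogonality to them would
  be a homogeneous system with a nonzero solution \<open>y\<close>, and \<open>y\<close> would be a
  relation among the rows.\<close>

lemma full_rank_if_transpose_inj: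
  fixes M :: "'a::field mat"
  assumes M: "M \<in> carrier_mat m n"
    and inj: "\<And>y. y \<in> carrier_vec m \<Longrightarrow> M\<^sup>T *\<^sub>v y = 0\<^sub>v n \<Longrightarrow> y = 0\<^sub>v m"
  shows "vec_space.rank m M = m"
proof (rule ccontr)
  interpret vec_space "TYPE('a)" m .
  assume "rank M \<noteq> m"
  obtain S where S: "S \<subseteq> set (cols M)" "lin_indpt S" "finite S" "card S = rank M"
    "set (cols M) \<subseteq> span S"
    using maximal_independent_cols[OF M] .
  have SC: "S \<subseteq> carrier_vec m" using S(1) cols_dim M by blast
  have "card S \<le> m" using li_le_dim(2)[of S] S SC by (simp add: dim_is_n)
  then have "card S < m" using S(4) \<open>rank M \<noteq> m\<close> by simp
  obtain xs where xs: "set xs = S" "length xs = card S"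
    using finite_distinct_list[OF S(3)] distinct_card by metis
  obtain y where y: "y \<in> carrier_vec m" "y \<noteq> 0\<^sub>v m" "mat_of_rows m xs *\<^sub>v y = 0\<^sub>v (card S)"
    using mat_kernel_nontrivial[OF _ \<open>card S < m\<close>, of "mat_of_rows m xs"] mat_of_rows_carrier(1)[of m xs] xs(2)
    by metis
  have "y \<bullet> x = 0" if xS: "x \<in> S" for x
  proof -
    obtain k where k: "k < length xs" "x = xs ! k"
      using xS xs(1) by (metis in_set_conv_nth)
    have x: "x \<in> carrier_vec m" using that SC by auto
    have "row (mat_of_rows m xs) k = x" unfolding k(2) by (rule mat_of_rows_row[OF k(1)]) (use k(2) x in simp)
    then have "x \<bullet> y = (mat_of_rows m xs *\<^sub>v y) $ k"
      using index_mult_mat_vec[of k "mat_of_rows m xs" y] k(1) by simp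
    then show ?thesis using y(3) k(1) xs(2) comm_scalar_prod[OF x y(1)] by simp
  qed
  then have "y \<in> orthogonal_complement S" using y(1) by (simp add: orthogonal_complement_def)
  \<comment> \<open>Orthogonality passes from \<open>S\<close> to its span, which contains every
    column of \<open>M\<close>.\<close>
  then have "y \<in> orthogonal_complement (span S)" using SC by simp
  then have *: "y \<bullet> x = 0" if "x \<in> set (cols M)" for x
    using that S(5) by (auto simp: orthogonal_complement_def)
  have "M\<^sup>T *\<^sub>v y = 0\<^sub>v n"
  proof (rule eq_vecI)
    fix j assume "j < dim_vec (0\<^sub>v n :: 'a vec)"
    then have j: "j < n" by simp
    then have "col M j \<in> set (cols M)" using M by (auto simp: cols_def)
    from *[OF this] show "(M\<^sup>T *\<^sub>v y) $ j = 0\<^sub>v n $ j"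
      using j M y(1) comm_scalar_prod[of y m "col M j"] by simp
  qed (use M in auto)
  with inj y show False by blast
qed

lemma transpose_inj_if_rank_transpose:
  fixes M :: "'a::field mat"
  assumes M: "M \<in> carrier_mat m n" and rank: "vec_space.rank n (M\<^sup>T) = m"
    and y: "y \<in> carrier_vec m" "M\<^sup>T *\<^sub>v y = 0\<^sub>v n"
  shows "y = 0\<^sub>v m"
proof -
  interpret vec_space "TYPE('a)" n .
  have Mt: "M\<^sup>T \<in> carrier_mat n m" using M by simp
  obtain S where "S \<subseteq> set (cols (M\<^sup>T))" "card S = m"
    using maximal_independent_cols[OF Mt] rank by metis
  \<comment> \<open>Independence of the set of columns would not notice a repeated column. The rank
    rules this out: the \<open>m\<close> columns form a set of at least \<open>m\<close>
    vectors.\<close>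
  then have "m \<le> card (set (cols (M\<^sup>T)))" by (metis List.finite_set card_mono)
  then have "distinct (cols (M\<^sup>T))"
    using Mt by (intro card_distinct le_antisym card_length) auto
  then show ?thesis using lin_depI[OF Mt y(1) _ y(2)] full_rank_lin_indpt[OF Mt rank] by blast
qed

text \<open>Independent rows give \<open>M\<close> a nonzero minor of size \<open>m\<close>.
  Transposed, it is a minor of \<open>M\<^sup>T\<close> that uses all \<open>m\<close> columns,
  which bounds the rank from below.\<close>

lemma rank_transpose_if_transpose_inj:
  fixes M :: "'a::field mat"
  assumes M: "M \<in> carrier_mat m n"
    and inj: "\<And>y. y \<in> carrier_vec m \<Longrightarrow> M\<^sup>T *\<^sub>v y = 0\<^sub>v n \<Longrightarrow> y = 0\<^sub>v m"
  shows "vec_space.rank n (M\<^sup>T) = m"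
proof -
  interpret vec_space "TYPE('a)" n .
  have Mt: "M\<^sup>T \<in> carrier_mat n m" using M by simp
  obtain J where J: "J \<in> index_sets n m" "det (submatrix M UNIV J) \<noteq> 0"
    using nonzero_minor_if_full_rank[OF M full_rank_if_transpose_inj[OF M inj]] .
  have "submatrix (M\<^sup>T) J UNIV = (submatrix M UNIV J)\<^sup>T"
    using M by (intro eq_matI) (auto simp: submatrix_def pick_UNIV pick_le)
  then have "det (submatrix (M\<^sup>T) J UNIV) \<noteq> 0"
    using J det_transpose[OF submatrix_UNIV_carrier[OF M J(1)]] by simp
  from rank_gt_minor[OF Mt this] rank_le_nc[OF Mt] show ?thesis by simp
qed

text \<open>The row space is the column space of \<open>M\<^sup>T\<close>, so its dimension is by
  definition the rank of the transpose.\<close>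

lemma linear_subspace_row_space:
  fixes M :: "'a::field mat"
  assumes M: "M \<in> carrier_mat m n"
    and inj: "\<And>y. y \<in> carrier_vec m \<Longrightarrow> M\<^sup>T *\<^sub>v y = 0\<^sub>v n \<Longrightarrow> y = 0\<^sub>v m"
  shows "linear_subspace n m (vec_space.row_space n M)"
proof -
  interpret vec_space "TYPE('a)" n .
  have "set (rows M) \<subseteq> carrier_vec n" using M rows_carrier[of M] by auto
  then show ?thesis
    using span_is_subspace[of "set (rows M)"] rank_transpose_if_transpose_inj[OF M inj]
    by (simp add: linear_subspace_def row_space_def rank_def)
qed

lemma transpose_inj_if_linear_subspace:
  fixes W :: "'a::field mat"
  assumes "W \<in> carrier_mat m n" "linear_subspace n m (vec_space.row_space n W)"
    and "y \<in> carrier_vec m" "W\<^sup>T *\<^sub>v y = 0\<^sub>v n"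
  shows "y = 0\<^sub>v m"
  using assms transpose_inj_if_rank_transpose[of W m n y]
  by (simp add: linear_subspace_def vec_space.row_space_def vec_space.rank_def)

text \<open>The rows of \<open>W\<close> are a basis of \<open>X\<close>. It is found as a maximal
  independent subset, which exists because independent sets in \<open>K^n\<close> have at most
  \<open>n\<close> elements.\<close>

lemma linear_subspace_obtain_matrix:
  fixes X :: "'a::field vec set"
  assumes "linear_subspace n m X"
  obtains W where "W \<in> carrier_mat m n" "X = vec_space.row_space n W"
proof -
  interpret vec_space "TYPE('a)" n .
  have sub: "VectorSpace.subspace class_ring X V" and dim: "vectorspace.dim class_ring (vs X) = m"
    using assms by (auto simp: linear_subspace_def)
  have XC: "X \<subseteq> carrier_vec n" using sub by (auto simp: VectorSpace.subspace_def submodule_def)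
  have subm: "submodule class_ring X V" using sub by (simp add: VectorSpace.subspace_def)
  interpret X: vectorspace class_ring "vs X" by (rule subspace_is_vs[OF sub])
  let ?P = "\<lambda>T. T \<subseteq> X \<and> X.lin_indpt T"
  \<comment> \<open>Independence inside the subspace agrees with independence in \<open>K^n\<close>,
    so the bound from the ambient space applies.\<close>
  have li: "X.lin_indpt T \<longleftrightarrow> lin_indpt T" if "T \<subseteq> X" for T
    using span_li_not_depend(2)[OF that subm] by simp
  have "?P {}" by (auto simp: X.lin_dep_def)
  moreover have "finite T \<and> card T \<le> n" if "?P T" for T
    using li_le_dim[of T] that li[of T] XC by (auto simp: dim_is_n)
  ultimately obtain S where S: "finite S" "maximal S ?P"
    using maximal_exists[of ?P n "{}"] by blast
  then have basis: "X.basis S" using X.max_li_is_basis[of S] by simp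
  then have "card S = m" using X.dim_basis[of S] S dim by simp
  moreover obtain xs where xs: "set xs = S" "distinct xs" using finite_distinct_list[OF S(1)] by blast
  ultimately have len: "length xs = m" using distinct_card by metis
  have SX: "S \<subseteq> X" using basis by (simp add: X.basis_def)
  have "rows (mat_of_rows n xs) = xs" using xs SX XC by (intro rows_mat_of_rows) auto
  moreover have "span S = X"
    using span_li_not_depend(1)[OF SX subm] basis by (simp add: X.basis_def)
  ultimately show ?thesis
    using that[OF mat_of_rows_carrier(1)[of n xs, unfolded len]] xs(1) by (simp add: row_space_def)
qed

lemma transpose_inj_drop_first_row:
  fixes A :: "'a::field mat"
  assumes A: "A \<in> carrier_mat (Suc d) n"
    and inj: "\<And>y. y \<in> carrier_vec (Suc d) \<Longrightarrow> A\<^sup>T *\<^sub>v y = 0\<^sub>v n \<Longrightarrow> y = 0\<^sub>v (Suc d)"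
    and y: "y \<in> carrier_vec d" "(drop_first_row A)\<^sup>T *\<^sub>v y = 0\<^sub>v n"
  shows "y = 0\<^sub>v d"
proof -
  \<comment> \<open>A relation among the remaining rows becomes a relation among all rows when row 0
    gets coefficient 0.\<close>
  define z where "z = vec (Suc d) (\<lambda>i. if i = 0 then 0 else y $ (i - 1))"
  have z: "z \<in> carrier_vec (Suc d)" by (simp add: z_def)
  have "A\<^sup>T *\<^sub>v z = (drop_first_row A)\<^sup>T *\<^sub>v y"
  proof (rule eq_vecI)
    fix j assume "j < dim_vec ((drop_first_row A)\<^sup>T *\<^sub>v y)"
    then have j: "j < n" using A by (simp add: drop_first_row_def)
    have "(A\<^sup>T *\<^sub>v z) $ j = (\<Sum>i<Suc d. A $$ (i, j) * z $ i)"
      using A j z by (simp add: scalar_prod_def lessThan_atLeast0 del: sum.op_ivl_Suc)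
    also have "\<dots> = (\<Sum>i<d. A $$ (Suc i, j) * y $ i)"
      by (simp only: sum.lessThan_Suc_shift) (simp add: z_def)
    also have "\<dots> = ((drop_first_row A)\<^sup>T *\<^sub>v y) $ j"
      using A j y(1) by (auto simp: scalar_prod_def lessThan_atLeast0 drop_first_row_def intro!: sum.cong)
    finally show "(A\<^sup>T *\<^sub>v z) $ j = ((drop_first_row A)\<^sup>T *\<^sub>v y) $ j" .
  qed (use A in \<open>auto simp: drop_first_row_def\<close>)
  then have z0: "z = 0\<^sub>v (Suc d)" using inj[OF z] y(2) by simp
  show ?thesis
  proof (rule eq_vecI)
    fix i assume "i < dim_vec (0\<^sub>v d :: 'a vec)"
    then have "i < d" by simp
    then have "y $ i = z $ Suc i" by (simp add: z_def)
    then show "y $ i = 0\<^sub>v d $ i" using z0 \<open>i < d\<close> by simp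
  qed (use y in auto)
qed

lemma transpose_inj_mult:
  fixes W :: "'a::field mat"
  assumes P: "P \<in> carrier_mat m m" "Q \<in> carrier_mat m m" "P * Q = 1\<^sub>m m" and W: "W \<in> carrier_mat m n"
    and inj: "\<And>y. y \<in> carrier_vec m \<Longrightarrow> W\<^sup>T *\<^sub>v y = 0\<^sub>v n \<Longrightarrow> y = 0\<^sub>v m"
    and y: "y \<in> carrier_vec m" "(P * W)\<^sup>T *\<^sub>v y = 0\<^sub>v n"
  shows "y = 0\<^sub>v m"
proof -
  have T: "P\<^sup>T \<in> carrier_mat m m" "Q\<^sup>T \<in> carrier_mat m m" "W\<^sup>T \<in> carrier_mat n m" using P W by auto
  have "W\<^sup>T *\<^sub>v (P\<^sup>T *\<^sub>v y) = 0\<^sub>v n"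
    using y assoc_mult_mat_vec[OF T(3,1) y(1)] by (simp add: transpose_mult[OF P(1) W])
  then have "P\<^sup>T *\<^sub>v y = 0\<^sub>v m" using inj T y by simp
  moreover have "Q\<^sup>T *\<^sub>v 0\<^sub>v m = 0\<^sub>v m" using T by (intro eq_vecI) auto
  ultimately have "Q\<^sup>T * P\<^sup>T *\<^sub>v y = 0\<^sub>v m" using assoc_mult_mat_vec[OF T(2,1) y(1)] T by simp
  then show ?thesis using y(1) by (simp add: transpose_mult[OF P(1,2), symmetric] P(3))
qed

section \<open>Inclusion of row spaces as matrix factorization\<close>

lemma row_space_mult_subset:
  fixes W :: "'a::field mat"
  assumes A: "A \<in> carrier_mat k m" and W: "W \<in> carrier_mat m n"
  shows "vec_space.row_space n (A * W) \<subseteq> vec_space.row_space n W"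
proof
  interpret vec_space "TYPE('a)" n .
  have T: "A\<^sup>T \<in> carrier_mat m k" "W\<^sup>T \<in> carrier_mat n m" using A W by auto
  fix w assume "w \<in> row_space (A * W)"
  then obtain y where y: "y \<in> carrier_vec k" "w = W\<^sup>T * A\<^sup>T *\<^sub>v y"
    using A W by (auto simp: row_space_eq[OF mult_carrier_mat[OF A W]] transpose_mult[OF A W])
  then have "w = W\<^sup>T *\<^sub>v (A\<^sup>T *\<^sub>v y)" using assoc_mult_mat_vec[OF T(2,1)] by simp
  then show "w \<in> row_space W" using T y by (auto simp: row_space_eq[OF W])
qed

lemma row_space_subset_obtain_factor:
  fixes W :: "'a::field mat"
  assumes M: "M \<in> carrier_mat k n" and W: "W \<in> carrier_mat m n"
    and sub: "vec_space.row_space n M \<subseteq> vec_space.row_space n W"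
  obtains A where "A \<in> carrier_mat k m" "M = A * W"
proof -
  interpret vec_space "TYPE('a)" n .
  have "\<exists>y \<in> carrier_vec m. W\<^sup>T *\<^sub>v y = row M i" if "i < k" for i
  proof -
    have "row M i \<in> set (rows M)" using that M by (auto simp: rows_def)
    moreover have "set (rows M) \<subseteq> row_space M"
      unfolding row_space_def using M rows_carrier[of M] by (intro in_own_span) auto
    ultimately have "row M i \<in> row_space W" using sub by blast
    then show ?thesis using W by (auto simp: row_space_eq[OF W])
  qed
  then obtain y where y: "y i \<in> carrier_vec m" "W\<^sup>T *\<^sub>v y i = row M i" if "i < k" for i by metis
  define A where "A = mat k m (\<lambda>(i, j). y i $ j)"
  have A: "A \<in> carrier_mat k m" by (simp add: A_def)
  have "M = A * W"
  proof (rule eq_matI)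
    fix i j assume "i < dim_row (A * W)" "j < dim_col (A * W)"
    then have ij: "i < k" "j < n" using A W by auto
    have "row A i = y i" using ij y(1)[OF ij(1)] by (intro eq_vecI) (auto simp: A_def)
    moreover have "M $$ (i, j) = (W\<^sup>T *\<^sub>v y i) $ j" using ij M y(2)[OF ij(1)] by simp
    ultimately show "M $$ (i, j) = (A * W) $$ (i, j)"
      using ij A W y(1)[OF ij(1)] comm_scalar_prod[of "col W j" m "y i"] by simp
  qed (use A M W in auto)
  with that A show ?thesis by blast
qed

section \<open>The linear system of hyperplanes\<close>

lemma proj_point_scale_fun:
  assumes "a \<noteq> 0"
  shows "proj_point (scale_fun a f) = proj_point f"
proof -
  have "f = scale_fun (inverse a) (scale_fun a f)" using assms by (simp add: scale_fun_def mult.assoc[symmetric])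
  then have "f \<in> fun_vs.span {scale_fun a f}"
    by (metis fun_vs.span_base fun_vs.span_scale singletonI)
  moreover have "scale_fun a f \<in> fun_vs.span {f}"
    by (simp add: fun_vs.span_base fun_vs.span_scale)
  ultimately show ?thesis
    unfolding proj_point_def by (simp add: fun_vs.span_eq)
qed

lemma minor_comb_zero: "minor_comb d n W (0\<^sub>v (Suc d)) = 0"
  by (auto simp: minor_comb_def scale_fun_def fun_eq_iff sum_fun_apply simp del: sum.lessThan_Suc)

text \<open>\<open>minor_comb\<close> is linear in \<open>c\<close>, so its image is a subspace, and
  unit vectors yield the rows themselves. Elements of the span thereby acquire explicit coefficient
  vectors.\<close>

lemma minor_row_space_eq:
  "minor_row_space d n W = minor_comb d n W ` carrier_vec (Suc d)" (is "?L = ?R")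
proof
  have sub: "fun_vs.subspace ?R"
    unfolding fun_vs.subspace_def
  proof (intro conjI ballI allI)
    show "0 \<in> ?R" using minor_comb_zero by (metis imageI zero_carrier_vec)
    fix u v a assume "u \<in> ?R"
    then obtain b where b: "b \<in> carrier_vec (Suc d)" "u = minor_comb d n W b" by blast
    have "scale_fun a u = minor_comb d n W (a \<cdot>\<^sub>v b)" using b
      by (auto simp: minor_comb_def scale_fun_def fun_eq_iff sum_fun_apply sum_distrib_left mult.assoc
          simp del: sum.lessThan_Suc intro!: sum.cong)
    then show "scale_fun a u \<in> ?R" using b by simp
    assume "v \<in> ?R"
    then obtain c where c: "c \<in> carrier_vec (Suc d)" "v = minor_comb d n W c" by blast
    have "u + v = minor_comb d n W (b + c)" using b c
      by (auto simp: minor_comb_def scale_fun_def fun_eq_iff sum_fun_apply sum.distrib distrib_right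
          simp del: sum.lessThan_Suc)
    then show "u + v \<in> ?R" using b c by simp
  qed
  have "minor_matrix d n W i \<in> ?R" if "i < d + 1" for i
  proof
    have "minor_comb d n W (unit_vec (Suc d) i) = (\<Sum>k<Suc d. if k = i then minor_matrix d n W i else 0)"
      unfolding minor_comb_def using that by (intro sum.cong) (auto simp: scale_fun_def fun_eq_iff)
    then show "minor_matrix d n W i = minor_comb d n W (unit_vec (Suc d) i)"
      using that by (simp del: sum.lessThan_Suc)
  qed simp
  then show "?L \<subseteq> ?R" unfolding minor_row_space_def
    by (intro fun_vs.span_minimal sub) auto
  show "?R \<subseteq> ?L"
    unfolding minor_comb_def minor_row_space_def
    by (intro image_subsetI fun_vs.span_sum fun_vs.span_scale fun_vs.span_base) auto
qed

text \<open>Independence of the rows is stated as injectivity of the transpose, a form that passes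
  easily through a change of basis and the deletion of a row.\<close>

locale full_row_rank =
  fixes d n :: nat and W :: "'a::field mat"
  assumes W: "W \<in> carrier_mat (Suc d) n"
    and inj: "\<And>y. y \<in> carrier_vec (Suc d) \<Longrightarrow> W\<^sup>T *\<^sub>v y = 0\<^sub>v n \<Longrightarrow> y = 0\<^sub>v (Suc d)"
begin

lemma obtain_hyperplane:
  assumes c: "c \<in> carrier_vec (Suc d)" "c \<noteq> 0\<^sub>v (Suc d)"
  obtains M a where "M \<in> carrier_mat d n" "vec_space.rank d M = d"
    "linear_subspace n d (vec_space.row_space n M)"
    "vec_space.row_space n M \<subseteq> vec_space.row_space n W"
    "a \<noteq> 0" "plucker_coords M = scale_fun a (minor_comb d n W c)"
proof -
  obtain P Q where P: "P \<in> carrier_mat (Suc d) (Suc d)" and Q: "Q \<in> carrier_mat (Suc d) (Suc d)"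
    and PQ: "P * Q = 1\<^sub>m (Suc d)" and Pc: "P *\<^sub>v c = unit_vec (Suc d) 0" and det: "det P \<noteq> 0"
    using invertible_first_column[OF c] by metis
  note PW = mult_carrier_mat[OF P W]
  define M where "M = drop_first_row (P * W)"
  have M: "M \<in> carrier_mat d n" unfolding M_def using PW by (rule drop_first_row_carrier)
  have injM: "y = 0\<^sub>v d" if "y \<in> carrier_vec d" "M\<^sup>T *\<^sub>v y = 0\<^sub>v n" for y
    using transpose_inj_drop_first_row[OF PW transpose_inj_mult[OF P Q PQ W inj]] that
    unfolding M_def by blast
  show ?thesis
  proof
    show "vec_space.rank d M = d" by (rule full_rank_if_transpose_inj[OF M injM])
    show "linear_subspace n d (vec_space.row_space n M)" by (rule linear_subspace_row_space[OF M injM])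
    show "vec_space.row_space n M \<subseteq> vec_space.row_space n W"
      unfolding M_def drop_first_row_mult[OF P W]
      by (rule row_space_mult_subset[OF drop_first_row_carrier[OF P] W])
    show "plucker_coords M = scale_fun (det P) (minor_comb d n W c)"
      unfolding M_def by (rule plucker_coords_drop_first_row[OF W P c(1) Pc])
  qed (use M det in auto)
qed

text \<open>Independence of the rows of V comes from geometry: a nonzero \<open>c\<close> yields a
  full-rank \<open>M\<close>, whose nonzero Pluecker vector is a multiple of the
  combination.\<close>

lemma minor_comb_eq_0_iff:
  assumes "c \<in> carrier_vec (Suc d)"
  shows "minor_comb d n W c = 0 \<longleftrightarrow> c = 0\<^sub>v (Suc d)"
proof
  assume *: "minor_comb d n W c = 0"
  show "c = 0\<^sub>v (Suc d)"
  proof (rule ccontr)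
    assume "c \<noteq> 0\<^sub>v (Suc d)"
    then obtain M a where "M \<in> carrier_mat d n" "vec_space.rank d M = d"
      "plucker_coords M = scale_fun a (minor_comb d n W c)"
      using obtain_hyperplane[OF assms] by metis
    then show False using plucker_coords_nonzero[of M d] * by (simp add: scale_fun_def fun_eq_iff)
  qed
qed (simp add: minor_comb_zero)

lemma dim_minor_row_space: "fun_vs.dim (minor_row_space d n W) = Suc d"
proof -
  let ?V = "minor_matrix d n W"
  have zero: "a i = 0" if "(\<Sum>i<Suc d. scale_fun (a i) (?V i)) = 0" "i < Suc d" for a i
  proof -
    have "minor_comb d n W (vec (Suc d) a) = (\<Sum>i<Suc d. scale_fun (a i) (?V i))"
      unfolding minor_comb_def by (intro sum.cong) auto
    then have "vec (Suc d) a = 0\<^sub>v (Suc d)" using minor_comb_eq_0_iff[of "vec (Suc d) a"] that(1) by simp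
    then show "a i = 0" using that(2) by (metis index_vec index_zero_vec(1))
  qed
  \<comment> \<open>\<open>fun_vs.independent\<close> speaks of a set, so the rows of V must also be
    distinct for it to have \<open>Suc d\<close> elements. Two equal rows would satisfy a relation
    with coefficients 1 and -1.\<close>
  have injV: "inj_on ?V {..<Suc d}"
  proof (rule inj_onI, rule ccontr)
    fix i j assume ij: "i \<in> {..<Suc d}" "j \<in> {..<Suc d}" "?V i = ?V j" "i \<noteq> j"
    define a where "a k = (if k = i then 1 else if k = j then -1 else 0 :: 'a)" for k
    have "(\<Sum>k<Suc d. scale_fun (a k) (?V k)) = (\<Sum>k\<in>{i, j}. scale_fun (a k) (?V k))"
      using ij by (intro sum.mono_neutral_right) (auto simp: a_def scale_fun_def fun_eq_iff)
    also have "\<dots> = 0" using ij by (auto simp: a_def scale_fun_def fun_eq_iff)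
    finally have "a i = 0" using zero[of a i] ij(1) by simp
    then show False by (simp add: a_def)
  qed
  have "fun_vs.independent (?V ` {..<Suc d})"
    unfolding fun_vs.dependent_finite[OF finite_imageI[OF finite_lessThan]]
    using zero[of "\<lambda>i. _ (?V i)"] by (auto simp: sum.reindex[OF injV] simp del: sum.lessThan_Suc)
  from fun_vs.dim_span_eq_card_independent[OF this] show ?thesis
    by (simp add: minor_row_space_def card_image[OF injV])
qed

lemma minor_row_space_subset: "minor_row_space d n W \<subseteq> coord_space (index_sets n d)"
  by (auto simp: minor_row_space_eq coord_space_def minor_comb_eq_det[OF W])

lemma L_row_space: "L d n (vec_space.row_space n W) = projectivization (minor_row_space d n W)"
proof (intro equalityI subsetI)
  fix p assume "p \<in> L d n (vec_space.row_space n W)"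
  then obtain M where M: "M \<in> carrier_mat d n" "vec_space.rank d M = d"
    "vec_space.row_space n M \<subseteq> vec_space.row_space n W" "p = proj_point (plucker_coords M)"
    by (auto simp: L_def plucker_embeds_def)
  \<comment> \<open>The rows of \<open>M\<close> lie in the row space of \<open>W\<close>; their
    coefficients are the rows of \<open>A\<close>.\<close>
  obtain A where A: "A \<in> carrier_mat d (Suc d)" "M = A * W"
    using row_space_subset_obtain_factor[OF M(1) W M(3)] .
  obtain c where "c \<in> carrier_vec (Suc d)" "plucker_coords M = minor_comb d n W c"
    using plucker_coords_mult[OF A(1) W] A(2) by metis
  then show "p \<in> projectivization (minor_row_space d n W)"
    using M(4) plucker_coords_nonzero[OF M(1,2)]
    by (auto simp: projectivization_def minor_row_space_eq)
next
  fix p assume "p \<in> projectivization (minor_row_space d n W)"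
  then obtain c where c: "c \<in> carrier_vec (Suc d)" "minor_comb d n W c \<noteq> 0"
    and p: "p = proj_point (minor_comb d n W c)"
    by (auto simp: projectivization_def minor_row_space_eq)
  then have "c \<noteq> 0\<^sub>v (Suc d)" using minor_comb_eq_0_iff by blast
  then obtain M a where M: "M \<in> carrier_mat d n" "vec_space.rank d M = d"
    and lin: "linear_subspace n d (vec_space.row_space n M)"
    and sub: "vec_space.row_space n M \<subseteq> vec_space.row_space n W"
    and a: "a \<noteq> 0" "plucker_coords M = scale_fun a (minor_comb d n W c)"
    using obtain_hyperplane[OF c(1)] by metis
  have "p = proj_point (plucker_coords M)" using a p by (simp add: proj_point_scale_fun)
  then have "plucker_embeds d n (vec_space.row_space n M) p"
    using M by (auto simp: plucker_embeds_def)
  then show "p \<in> L d n (vec_space.row_space n W)"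
    using lin sub by (auto simp: L_def Gr_def)
qed

end

theorem theorem1:
  fixes d n :: nat and X :: "'a::alg_closed_field vec set"
  assumes "n \<ge> d + 1"
    and "linear_subspace n (d + 1) X"
  shows "proj_linear_subspace (index_sets n d) d (L d n X) \<and>
    (\<forall>W \<in> carrier_mat (d + 1) n. X = vec_space.row_space n W \<longrightarrow>
       L d n X = projectivization (minor_row_space d n W))"
proof -
  \<comment> \<open>Since \<open>X\<close> has dimension \<open>d + 1\<close>, any
    \<open>d + 1\<close> rows spanning it are independent. This covers an arbitrary
    \<open>W\<close>, not just the one chosen next.\<close>
  have rank: "full_row_rank d n W" if "W \<in> carrier_mat (d + 1) n" "X = vec_space.row_space n W" for W
    using that assms(2) transpose_inj_if_linear_subspace[of W "d + 1" n]
    by unfold_locales auto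
  obtain W where W: "W \<in> carrier_mat (d + 1) n" "X = vec_space.row_space n W"
    using linear_subspace_obtain_matrix[OF assms(2)] .
  have "proj_linear_subspace (index_sets n d) d (L d n X)"
    unfolding proj_linear_subspace_def W(2) full_row_rank.L_row_space[OF rank[OF W]]
    using full_row_rank.minor_row_space_subset[OF rank[OF W]] full_row_rank.dim_minor_row_space[OF rank[OF W]]
    by (intro exI[of _ "minor_row_space d n W"]) (simp add: minor_row_space_def)
  moreover have "L d n X = projectivization (minor_row_space d n W')"
    if "W' \<in> carrier_mat (d + 1) n" "X = vec_space.row_space n W'" for W'
    using full_row_rank.L_row_space[OF rank[OF that]] that(2) by simp
  ultimately show ?thesis by blast
qed

end
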